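(* Let $K$ be a (nonempty) finite abstract simplicial complex. If $K$ is edge-path connected, then $\mathrm{TC}(K)\le \mathrm{scat}(K^2)$, where $\mathrm{TC}(K)$ is the discrete topological complexity of $K$, $K^2=K\,\Pi\,K$ is the categorical product, and $\mathrm{scat}$ is the normalized simplicial LS-category.
   Context: Contiguity: two simplicial maps $\varphi,\psi\colon K\to L$ are contiguous ($\varphi\sim_c\psi$) if for every simplex $\sigma\in K$ the union of vertex sets $\varphi(\sigma)\cup\psi(\sigma)$ is a simplex of $L$. They are in the same contiguity class ($\varphi\sim\psi$) if there is a finite sequence of simplicial maps $\varphi=h_0\sim_c h_1\sim_c\cdots\sim_c h_m=\psi$ from $K$ to $L$. A constant map sends every vertex of its domain to one fixed vertex. $K$ is edge-path connected if any two vertices are joined by a finite sequence of vertices in which any two consecutive ones span a simplex of $K$. Simplicial LS-category: for a complex $M$, a subcomplex $L\subset M$ is categorical if the inclusion $\iota_L\colon L\to M$ is in the same contiguity class as some constant map $L\to M$. The normalized simplicial LS-category $\mathrm{scat}\,M$ is the minimum $m\ge 0$ such that $M=L_0\cup\cdots\cup L_m$ with each $L_j$ a categorical subcomplex. Categorical product: $K^2=K\,\Pi\,K$ is the simplicial complex with vertex set $V(K)\times V(K)$, in which a finite set $\sigma$ of vertices is a simplex if and only if both projections $\pi_1(\sigma)$ and $\pi_2(\sigma)$ are simplices of $K$. The diagonal $\Delta\colon K\to K^2$ is the simplicial map $\Delta(v)=(v,v)$. A subcomplex $\Omega\subset K^2$, with inclusion $\iota_\Omega\colon\Omega\to K^2$,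 is a Farber subcomplex if there exists a simplicial map $\sigma\colon\Omega\to K$ such that $\Delta\circ\sigma\sim\iota_\Omega$. The discrete topological complexity $\mathrm{TC}(K)$ is the least integer $n\ge 0$ such that $K^2=\Omega_0\cup\cdots\cup\Omega_n$ for some Farber subcomplexes $\Omega_0,\dots,\Omega_n$ of $K^2$ ($\infty$ if there is no such $n$). *)

theory Defs
  imports Main "HOL-Library.Extended_Nat"
begin

text \<open>An abstract simplicial complex is represented by its set of simplices. Simplices are
  nonempty, so the empty complex is \<open>{}\<close>, and there are no vertices that are not simplices.\<close>

definition abstract_complex :: "'a set set \<Rightarrow> bool" where
  "abstract_complex K \<longleftrightarrow>
     (\<forall>\<sigma>\<in>K. finite \<sigma> \<and> \<sigma> \<noteq> {}) \<and> (\<forall>\<sigma>\<in>K. \<forall>\<tau>. \<tau> \<subseteq> \<sigma> \<and> \<tau> \<noteq> {} \<longrightarrow> \<tau> \<in> K)"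

definition vertices :: "'a set set \<Rightarrow> 'a set" where
  "vertices K = \<Union>K"

definition subcomplex :: "'a set set \<Rightarrow> 'a set set \<Rightarrow> bool" where
  "subcomplex L M \<longleftrightarrow> abstract_complex L \<and> L \<subseteq> M"

definition edge_path_connected :: "'a set set \<Rightarrow> bool" where
  "edge_path_connected K \<longleftrightarrow>
     (\<forall>v\<in>vertices K. \<forall>w\<in>vertices K. \<exists>(p :: nat \<Rightarrow> 'a) m.
        p 0 = v \<and> p m = w \<and> (\<forall>i\<le>m. p i \<in> vertices K) \<and> (\<forall>i<m. {p i, p (Suc i)} \<in> K))"

text \<open>Simplicial maps are total functions of which only the values on the vertices of the
  domain matter. Two simplicial maps that agree on these vertices are contiguous, so the
  irrelevant values do not affect contiguity classes.\<close>

definition simplicial_map :: "'a set set \<Rightarrow> 'b set set \<Rightarrow> ('a \<Rightarrow> 'b) \<Rightarrow> bool" where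
  "simplicial_map K L \<phi> \<longleftrightarrow> (\<forall>\<sigma>\<in>K. \<phi> ` \<sigma> \<in> L)"

definition contiguous :: "'a set set \<Rightarrow> 'b set set \<Rightarrow> ('a \<Rightarrow> 'b) \<Rightarrow> ('a \<Rightarrow> 'b) \<Rightarrow> bool" where
  "contiguous K L \<phi> \<psi> \<longleftrightarrow>
     simplicial_map K L \<phi> \<and> simplicial_map K L \<psi> \<and> (\<forall>\<sigma>\<in>K. \<phi> ` \<sigma> \<union> \<psi> ` \<sigma> \<in> L)"

definition same_contiguity_class ::
  "'a set set \<Rightarrow> 'b set set \<Rightarrow> ('a \<Rightarrow> 'b) \<Rightarrow> ('a \<Rightarrow> 'b) \<Rightarrow> bool" where
  "same_contiguity_class K L \<phi> \<psi> \<longleftrightarrow>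
     (\<exists>(h :: nat \<Rightarrow> 'a \<Rightarrow> 'b) m. h 0 = \<phi> \<and> h m = \<psi> \<and>
        (\<forall>i\<le>m. simplicial_map K L (h i)) \<and> (\<forall>i<m. contiguous K L (h i) (h (Suc i))))"

text \<open>The inclusion of a subcomplex is the function \<^term>\<open>id\<close>.\<close>

definition categorical_subcomplex :: "'a set set \<Rightarrow> 'a set set \<Rightarrow> bool" where
  "categorical_subcomplex M L \<longleftrightarrow>
     subcomplex L M \<and> (\<exists>v\<in>vertices M. same_contiguity_class L M id (\<lambda>_. v))"

text \<open>The infimum in \<^typ>\<open>enat\<close> of a nonempty set of naturals is its least element, and the
  infimum of the empty set is \<open>\<infinity>\<close>.\<close>

definition scat :: "'a set set \<Rightarrow> enat" where
  "scat M = Inf (enat ` {m. \<exists>L :: nat \<Rightarrow> 'a set set.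
     (\<forall>j\<le>m. categorical_subcomplex M (L j)) \<and> M = (\<Union>j\<le>m. L j)})"

definition categorical_product :: "'a set set \<Rightarrow> 'b set set \<Rightarrow> ('a \<times> 'b) set set" where
  "categorical_product K L =
     {\<sigma>. finite \<sigma> \<and> \<sigma> \<subseteq> vertices K \<times> vertices L \<and> fst ` \<sigma> \<in> K \<and> snd ` \<sigma> \<in> L}"

definition diagonal :: "'a \<Rightarrow> 'a \<times> 'a" where
  "diagonal v = (v, v)"

definition farber_subcomplex :: "'a set set \<Rightarrow> ('a \<times> 'a) set set \<Rightarrow> bool" where
  "farber_subcomplex K \<Omega> \<longleftrightarrow>
     subcomplex \<Omega> (categorical_product K K) \<and>
     (\<exists>\<sigma> :: 'a \<times> 'a \<Rightarrow> 'a. simplicial_map \<Omega> K \<sigma> \<and>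
        same_contiguity_class \<Omega> (categorical_product K K) (diagonal \<circ> \<sigma>) id)"

definition TC :: "'a set set \<Rightarrow> enat" where
  "TC K = Inf (enat ` {n. \<exists>\<Omega> :: nat \<Rightarrow> ('a \<times> 'a) set set.
     (\<forall>j\<le>n. farber_subcomplex K (\<Omega> j)) \<and> categorical_product K K = (\<Union>j\<le>n. \<Omega> j)})"

lemma abstract_complex_face:
  "abstract_complex K \<Longrightarrow> \<sigma> \<in> K \<Longrightarrow> \<tau> \<subseteq> \<sigma> \<Longrightarrow> \<tau> \<noteq> {} \<Longrightarrow> \<tau> \<in> K"
  unfolding abstract_complex_def by blast

lemma abstract_complex_simplex:
  assumes "abstract_complex K" "\<sigma> \<in> K"
  shows "finite \<sigma>" "\<sigma> \<noteq> {}"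
proof -
  have "\<forall>\<sigma>\<in>K. finite \<sigma> \<and> \<sigma> \<noteq> {}"
    using assms(1) unfolding abstract_complex_def by (rule conjunct1)
  with assms(2) show "finite \<sigma>" "\<sigma> \<noteq> {}" by auto
qed

lemma abstract_complex_categorical_product:
  assumes "abstract_complex K" "abstract_complex L"
  shows "abstract_complex (categorical_product K L)"
  unfolding abstract_complex_def
proof (intro conjI ballI allI impI)
  fix \<sigma> assume s: "\<sigma> \<in> categorical_product K L"
  then show "finite \<sigma>" by (simp add: categorical_product_def)
  have "{} \<notin> K"
    using abstract_complex_simplex(2)[OF assms(1)] by blast
  with s show "\<sigma> \<noteq> {}"
    by (auto simp: categorical_product_def)
  fix \<tau> assume t: "\<tau> \<subseteq> \<sigma> \<and> \<tau> \<noteq> {}"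
  have "fst ` \<tau> \<in> K" "snd ` \<tau> \<in> L"
  proof -
    have "fst ` \<sigma> \<in> K" "snd ` \<sigma> \<in> L"
      using s by (auto simp: categorical_product_def)
    moreover have "fst ` \<tau> \<subseteq> fst ` \<sigma>" "snd ` \<tau> \<subseteq> snd ` \<sigma>" "fst ` \<tau> \<noteq> {}" "snd ` \<tau> \<noteq> {}"
      using t by auto
    ultimately show "fst ` \<tau> \<in> K" "snd ` \<tau> \<in> L"
      using abstract_complex_face[OF assms(1), of "fst ` \<sigma>" "fst ` \<tau>"]
        abstract_complex_face[OF assms(2), of "snd ` \<sigma>" "snd ` \<tau>"]
      by simp_all
  qed
  then show "\<tau> \<in> categorical_product K L"
    using s t finite_subset[of \<tau> \<sigma>] subset_trans[of \<tau> \<sigma>]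
    by (simp add: categorical_product_def)
qed

lemma vertices_categorical_product:
  assumes "abstract_complex K" "abstract_complex L"
  shows "vertices (categorical_product K L) = vertices K \<times> vertices L"
proof
  show "vertices (categorical_product K L) \<subseteq> vertices K \<times> vertices L"
    by (auto simp: categorical_product_def vertices_def)
  show "vertices K \<times> vertices L \<subseteq> vertices (categorical_product K L)"
  proof clarify
    fix v w assume vw: "v \<in> vertices K" "w \<in> vertices L"
    then obtain \<sigma> \<tau> where "\<sigma> \<in> K" "v \<in> \<sigma>" "\<tau> \<in> L" "w \<in> \<tau>"
      unfolding vertices_def by blast
    then have "{v} \<in> K" "{w} \<in> L"
      using abstract_complex_face[OF assms(1), of \<sigma> "{v}"]
        abstract_complex_face[OF assms(2), of \<tau> "{w}"] by simp_all
    with vw have "{(v, w)} \<in> categorical_product K L"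
      by (simp add: categorical_product_def)
    then show "(v, w) \<in> vertices (categorical_product K L)"
      unfolding vertices_def by blast
  qed
qed

lemma simplicial_map_diagonal:
  assumes "abstract_complex K"
  shows "simplicial_map K (categorical_product K K) diagonal"
  unfolding simplicial_map_def
proof
  fix \<sigma> assume "\<sigma> \<in> K"
  moreover from this have "finite \<sigma>" using abstract_complex_simplex(1)[OF assms] by simp
  moreover from \<open>\<sigma> \<in> K\<close> have "diagonal ` \<sigma> \<subseteq> vertices K \<times> vertices K"
    unfolding diagonal_def vertices_def by blast
  ultimately show "diagonal ` \<sigma> \<in> categorical_product K K"
    by (simp add: categorical_product_def diagonal_def image_image)
qed

end

theory Submission
  imports Defs
begin

text \<open>The inequality holds because every categorical subcomplex of \<open>K \<Pi> K\<close> is already a Farber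
  subcomplex, so a cover that realises the simplicial category is also admissible for the
  topological complexity. Suppose that the inclusion of \<open>\<Omega>\<close> is in the contiguity class of the
  constant map at \<open>(v, w)\<close>. An edge path in \<open>K\<close> from \<open>v\<close> to \<open>w\<close> moves this constant map, through
  constant maps at the points \<open>(v, p i)\<close>, to the constant map at the diagonal point \<open>(v, v)\<close>. The
  latter is the diagonal composed with the constant map at \<open>v\<close>, which therefore serves as the
  simplicial map required of a Farber subcomplex.

  The lemma \<open>same_contiguity_class_const_snd\<close> moves the constant map, and
  \<open>categorical_imp_farber\<close> draws the conclusion. Being in the same contiguity class is handled as
  the reflexive transitive closure of contiguity, which supplies symmetry and transitivity.\<close>

lemma contiguous_sym: "contiguous K L \<phi> \<psi> \<Longrightarrow> contiguous K L \<psi> \<phi>"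
  by (auto simp: contiguous_def Un_commute)

text \<open>Chains of maps are sequences indexed by an initial segment of the naturals, hence powers of
  the contiguity relation. Simpliciality of one end has to be recorded separately: a chain of
  length zero says nothing about its only map.\<close>

lemma same_contiguity_class_iff_rtranclp:
  "same_contiguity_class K L \<phi> \<psi> \<longleftrightarrow> simplicial_map K L \<phi> \<and> (contiguous K L)\<^sup>*\<^sup>* \<phi> \<psi>"
proof
  assume "same_contiguity_class K L \<phi> \<psi>"
  then obtain h m where h: "h 0 = \<phi>" "h m = \<psi>" "\<forall>i\<le>m. simplicial_map K L (h i)"
    "\<forall>i<m. contiguous K L (h i) (h (Suc i))"
    unfolding same_contiguity_class_def by blast
  then have "(contiguous K L ^^ m) \<phi> \<psi>"
    unfolding relpowp_fun_conv by blast
  moreover have "simplicial_map K L \<phi>"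
    using h by auto
  ultimately show "simplicial_map K L \<phi> \<and> (contiguous K L)\<^sup>*\<^sup>* \<phi> \<psi>"
    by (auto intro: relpowp_imp_rtranclp)
next
  assume *: "simplicial_map K L \<phi> \<and> (contiguous K L)\<^sup>*\<^sup>* \<phi> \<psi>"
  then obtain m h where h: "h 0 = \<phi>" "h m = \<psi>" "\<forall>i<m. contiguous K L (h i) (h (Suc i))"
    unfolding rtranclp_power relpowp_fun_conv by blast
  have "simplicial_map K L (h i)" if "i \<le> m" for i
  proof (cases i)
    case 0
    then show ?thesis using * h(1) by simp
  next
    case (Suc j)
    then show ?thesis using h(3) that by (auto simp: contiguous_def)
  qed
  with h show "same_contiguity_class K L \<phi> \<psi>"
    unfolding same_contiguity_class_def by blast
qed

lemma same_contiguity_class_sym: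
  assumes "same_contiguity_class K L \<phi> \<psi>"
  shows "same_contiguity_class K L \<psi> \<phi>"
proof -
  have "simplicial_map K L \<psi>"
    using assms unfolding same_contiguity_class_def by auto
  moreover have "symp (contiguous K L)\<^sup>*\<^sup>*"
    by (rule symp_rtranclp, rule sympI, erule contiguous_sym)
  then have "(contiguous K L)\<^sup>*\<^sup>* \<psi> \<phi>"
    using assms by (auto simp: same_contiguity_class_iff_rtranclp elim: sympE)
  ultimately show ?thesis
    by (simp add: same_contiguity_class_iff_rtranclp)
qed

lemma same_contiguity_class_trans:
  "same_contiguity_class K L \<phi> \<psi> \<Longrightarrow> same_contiguity_class K L \<psi> \<chi> \<Longrightarrow> same_contiguity_class K L \<phi> \<chi>"
  by (auto simp: same_contiguity_class_iff_rtranclp)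

lemma singleton_mem_complex:
  assumes "abstract_complex K" "v \<in> vertices K"
  shows "{v} \<in> K"
  using assms(2) by (auto simp: vertices_def intro: abstract_complex_face[OF assms(1)])

lemma simplicial_map_const:
  assumes "abstract_complex \<Omega>" "{v} \<in> M"
  shows "simplicial_map \<Omega> M (\<lambda>_. v)"
  using assms(2) abstract_complex_simplex(2)[OF assms(1)]
  by (simp add: simplicial_map_def image_constant_conv)

text \<open>Two constant maps at the ends of an edge are contiguous: the union of their images on any
  simplex is that edge.\<close>

lemma contiguous_const:
  assumes "abstract_complex \<Omega>" "{v} \<in> M" "{w} \<in> M" "{v, w} \<in> M"
  shows "contiguous \<Omega> M (\<lambda>_. v) (\<lambda>_. w)"
  unfolding contiguous_def
proof (intro conjI ballI simplicial_map_const assms)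
  fix \<sigma> assume "\<sigma> \<in> \<Omega>"
  then have "\<sigma> \<noteq> {}"
    using abstract_complex_simplex(2)[OF assms(1)] by blast
  then show "(\<lambda>_. v) ` \<sigma> \<union> (\<lambda>_. w) ` \<sigma> \<in> M"
    using assms(4) by (simp add: image_constant_conv insert_commute)
qed

text \<open>An edge path in the second factor lifts to an edge path in the product, since an edge whose
  first coordinate is constant projects to a vertex and to an edge.\<close>

lemma same_contiguity_class_const_snd:
  assumes \<Omega>: "abstract_complex \<Omega>" and K: "abstract_complex K" and L: "abstract_complex L"
    and "edge_path_connected L" and u: "u \<in> vertices K"
    and "v \<in> vertices L" "w \<in> vertices L"
  shows "same_contiguity_class \<Omega> (categorical_product K L) (\<lambda>_. (u, v)) (\<lambda>_. (u, w))"
proof -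
  obtain p :: "nat \<Rightarrow> 'c" and m where p: "p 0 = v" "p m = w"
    "\<forall>i\<le>m. p i \<in> vertices L" "\<forall>i<m. {p i, p (Suc i)} \<in> L"
    using assms(4)[unfolded edge_path_connected_def, rule_format, OF assms(6,7)] by metis
  have point: "{(u, p i)} \<in> categorical_product K L" if "i \<le> m" for i
    using p(3) that u singleton_mem_complex[OF K] singleton_mem_complex[OF L]
    by (simp add: categorical_product_def)
  have edge: "{(u, p i), (u, p (Suc i))} \<in> categorical_product K L" if "i < m" for i
    using p(3,4) that u singleton_mem_complex[OF K] by (simp add: categorical_product_def)
  let ?h = "\<lambda>i _. (u, p i)"
  have "?h 0 = (\<lambda>_. (u, v))" "?h m = (\<lambda>_. (u, w))"
    using p(1,2) by simp_all
  moreover have "\<forall>i\<le>m. simplicial_map \<Omega> (categorical_product K L) (?h i)"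
    by (intro allI impI simplicial_map_const[OF \<Omega>] point)
  moreover have "\<forall>i<m. contiguous \<Omega> (categorical_product K L) (?h i) (?h (Suc i))"
    by (intro allI impI contiguous_const[OF \<Omega>] point edge) simp_all
  ultimately show ?thesis
    unfolding same_contiguity_class_def by (intro exI[of _ ?h] exI[of _ m]) simp
qed

text \<open>Contracting \<open>\<Omega>\<close> to \<open>(v, w)\<close> and then sliding \<open>w\<close> to \<open>v\<close> ends on the diagonal, so the
  constant map at \<open>v\<close> is a motion planner on \<open>\<Omega>\<close>.\<close>

lemma categorical_imp_farber:
  assumes K: "abstract_complex K" and conn: "edge_path_connected K"
    and "categorical_subcomplex (categorical_product K K) \<Omega>"
  shows "farber_subcomplex K \<Omega>"
proof -
  let ?M = "categorical_product K K"
  obtain v w where sub: "subcomplex \<Omega> ?M" and vw: "(v, w) \<in> vertices ?M"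
    and contraction: "same_contiguity_class \<Omega> ?M id (\<lambda>_. (v, w))"
    using assms(3) unfolding categorical_subcomplex_def by auto
  have v: "v \<in> vertices K" and w: "w \<in> vertices K"
    using vw by (simp_all add: vertices_categorical_product[OF K K])
  have \<Omega>: "abstract_complex \<Omega>"
    using sub by (simp add: subcomplex_def)
  have "same_contiguity_class \<Omega> ?M (\<lambda>_. (v, v)) (\<lambda>_. (v, w))"
    using same_contiguity_class_const_snd[OF \<Omega> K K conn v v w] .
  then have "same_contiguity_class \<Omega> ?M (\<lambda>_. (v, v)) id"
    using same_contiguity_class_sym[OF contraction] by (rule same_contiguity_class_trans)
  moreover have "diagonal \<circ> (\<lambda>_. v) = (\<lambda>_ :: 'a \<times> 'a. (v, v))"
    by (simp add: fun_eq_iff diagonal_def)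
  moreover have "simplicial_map \<Omega> K (\<lambda>_. v)"
    using simplicial_map_const[OF \<Omega> singleton_mem_complex[OF K v]] .
  ultimately show ?thesis
    using sub unfolding farber_subcomplex_def by (intro conjI exI[of _ "\<lambda>_. v"]) simp_all
qed

theorem theorem4p4:
  fixes K :: "'a set set"
  assumes "abstract_complex K" and "finite K" and "K \<noteq> {}"
    and "edge_path_connected K"
  shows "TC K \<le> scat (categorical_product K K)"
  unfolding TC_def scat_def
  using categorical_imp_farber[OF assms(1,4)]
  by (intro Inf_superset_mono image_mono) blast

end
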